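(* Let $(\mathcal X,d)$ be a metric space and let $X$ be an $\mathcal X$-valued random variable. A point $\hat x\in\mathcal X$ is a mode of $X$ if and only if $$\lim_{\epsilon\downarrow0}\frac{P(d(X,x)<\epsilon)}{P(d(X,\hat x)<\epsilon)}\le1\qquad\text{for all }x\in\mathcal X$$ (where the condition includes that the quotients are well defined and that the limits exist).
   Context: Fictitious density: a function $f:\mathcal X\to\mathbb R_{\ge0}$ is a fictitious density of $X$ if there exists $g:\mathbb R_{>0}\to\mathbb R_{>0}$ such that $\lim_{\epsilon\downarrow0}P(d(X,x)<\epsilon)/g(\epsilon)=f(x)$ for all $x\in\mathcal X$, and $f(x)>0$ for at least one $x\in\mathcal X$. Mode: $\hat x\in\mathcal X$ is a mode of $X$ if $X$ admits a fictitious density $f$ and $f(\hat x)=\max_{x\in\mathcal X}f(x)$. *)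

theory Defs
  imports "HOL-Probability.Probability"
begin

text \<open>The metric space is the whole type \<^typ>\<open>'a\<close> of class \<^class>\<open>metric_space\<close>. Functions into or between
  the (strictly) positive reals are total functions on \<^typ>\<open>real\<close> with explicit sign conditions; the
  values of \<open>g\<close> outside the positive reals are irrelevant, as limits are taken along \<open>at_right 0\<close>.\<close>

definition fictitious_density ::
  "'w measure \<Rightarrow> ('w \<Rightarrow> 'a::metric_space) \<Rightarrow> ('a \<Rightarrow> real) \<Rightarrow> bool" where
  "fictitious_density M X f \<longleftrightarrow>
     (\<forall>x. f x \<ge> 0) \<and>
     (\<exists>g :: real \<Rightarrow> real. (\<forall>\<epsilon>>0. g \<epsilon> > 0) \<and>
        (\<forall>x. ((\<lambda>\<epsilon>. \<P>(\<omega> in M. dist (X \<omega>) x < \<epsilon>) / g \<epsilon>) \<longlongrightarrow> f x) (at_right 0))) \<and>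
     (\<exists>x. f x > 0)"

text \<open>\<open>f x' = max f\<close>: the maximum is attained at \<open>x'\<close>.\<close>

definition is_mode :: "'w measure \<Rightarrow> ('w \<Rightarrow> 'a::metric_space) \<Rightarrow> 'a \<Rightarrow> bool" where
  "is_mode M X x' \<longleftrightarrow> (\<exists>f. fictitious_density M X f \<and> (\<forall>x. f x \<le> f x'))"

end

theory Submission imports Defs begin

text \<open>A fictitious density fixes a scale \<open>g\<close> on which all small-ball probabilities have a limit, and
  dividing two such limits eliminates \<open>g\<close>: the quotient of the small-ball probabilities at \<open>x\<close>
  and at a mode \<open>x'\<close> tends to \<open>f x / f x'\<close>, which is at most 1 by maximality. The division is
  legitimate because the maximum of a fictitious density is positive, and positivity of the limit
  forces every ball about \<open>x'\<close> to be charged (\<open>positive_limit_imp_balls_charged\<close>). Conversely, if the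
  quotients converge, the small-ball probability at \<open>x'\<close> itself serves as the scale; the limits of
  the quotients then form a fictitious density with value 1 at \<open>x'\<close>,
  and the bound 1 on the limits says that this value is the maximum.\<close>

lemma small_ball_event_measurable:
  fixes X :: "'w \<Rightarrow> 'a::metric_space"
  assumes "X \<in> borel_measurable M"
  shows "{\<omega> \<in> space M. dist (X \<omega>) x < r} \<in> sets M"
proof -
  have "X -` ball x r \<inter> space M \<in> sets M"
    using assms by (rule measurable_sets) simp
  also have "X -` ball x r \<inter> space M = {\<omega> \<in> space M. dist (X \<omega>) x < r}"
    by (auto simp: dist_commute)
  finally show ?thesis .
qed

lemma (in prob_space) small_ball_prob_mono:
  fixes X :: "'a \<Rightarrow> 'b::metric_space"
  assumes "X \<in> borel_measurable M" and "r \<le> s"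
  shows "\<P>(\<omega> in M. dist (X \<omega>) x < r) \<le> \<P>(\<omega> in M. dist (X \<omega>) x < s)"
  using assms(2) by (intro finite_measure_mono small_ball_event_measurable[OF assms(1)]) auto

text \<open>The positive limit makes the probabilities of arbitrarily small balls nonzero, and a larger
  ball has at least the probability of a smaller one.\<close>

lemma (in prob_space) positive_limit_imp_balls_charged:
  fixes X :: "'a \<Rightarrow> 'b::metric_space"
  assumes meas: "X \<in> borel_measurable M"
    and lim: "((\<lambda>\<epsilon>. \<P>(\<omega> in M. dist (X \<omega>) x < \<epsilon>) / g \<epsilon>) \<longlongrightarrow> l) (at_right 0)"
    and "l > 0" and "r > 0"
  shows "\<P>(\<omega> in M. dist (X \<omega>) x < r) > 0"
proof -
  have "\<forall>\<^sub>F \<epsilon> in at_right 0. \<P>(\<omega> in M. dist (X \<omega>) x < \<epsilon>) / g \<epsilon> > 0"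
    using order_tendstoD(1)[OF lim \<open>l > 0\<close>] .
  moreover have "\<forall>\<^sub>F \<epsilon> in at_right 0. \<epsilon> < r"
    using \<open>r > 0\<close> by (auto simp: eventually_at_right_field)
  ultimately have "\<forall>\<^sub>F \<epsilon> in at_right 0. \<P>(\<omega> in M. dist (X \<omega>) x < \<epsilon>) / g \<epsilon> > 0 \<and> \<epsilon> < r"
    by (rule eventually_conj)
  then obtain s where s: "\<P>(\<omega> in M. dist (X \<omega>) x < s) / g s > 0" "s < r"
    using eventually_happens'[OF trivial_limit_at_right_real] by blast
  have "0 < \<P>(\<omega> in M. dist (X \<omega>) x < s)"
    using s(1) by (simp add: zero_less_divide_iff less_le)
  also have "\<dots> \<le> \<P>(\<omega> in M. dist (X \<omega>) x < r)"
    using s(2) by (intro small_ball_prob_mono[OF meas]) simp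
  finally show ?thesis .
qed

text \<open>The scale cancels in the quotient. Where \<open>q \<epsilon> = 0\<close>, both sides of the cancellation are 0 by
  the convention for division by zero.\<close>

lemma tendsto_quotient_common_scale:
  fixes p q g :: "real \<Rightarrow> real"
  assumes p: "((\<lambda>\<epsilon>. p \<epsilon> / g \<epsilon>) \<longlongrightarrow> a) (at_right 0)"
    and q: "((\<lambda>\<epsilon>. q \<epsilon> / g \<epsilon>) \<longlongrightarrow> b) (at_right 0)"
    and "b \<noteq> 0" and g: "\<And>\<epsilon>. \<epsilon> > 0 \<Longrightarrow> g \<epsilon> > 0"
  shows "((\<lambda>\<epsilon>. p \<epsilon> / q \<epsilon>) \<longlongrightarrow> a / b) (at_right 0)"
proof (rule Lim_transform_eventually)
  show "((\<lambda>\<epsilon>. (p \<epsilon> / g \<epsilon>) / (q \<epsilon> / g \<epsilon>)) \<longlongrightarrow> a / b) (at_right 0)"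
    using p q \<open>b \<noteq> 0\<close> by (rule tendsto_divide)
  show "\<forall>\<^sub>F \<epsilon> in at_right 0. (p \<epsilon> / g \<epsilon>) / (q \<epsilon> / g \<epsilon>) = p \<epsilon> / q \<epsilon>"
    using eventually_at_right_less[of "0::real"]
  proof eventually_elim
    case (elim \<epsilon>)
    then show ?case using g[of \<epsilon>] by simp
  qed
qed

theorem proposition2p6:
  fixes M :: "'w measure" and X :: "'w \<Rightarrow> 'a::metric_space" and x' :: 'a
  assumes "prob_space M" and "X \<in> borel_measurable M"
  shows "is_mode M X x' \<longleftrightarrow>
    (\<forall>\<epsilon>>0. \<P>(\<omega> in M. dist (X \<omega>) x' < \<epsilon>) \<noteq> 0) \<and>
    (\<forall>x. \<exists>L::real.
       ((\<lambda>\<epsilon>. \<P>(\<omega> in M. dist (X \<omega>) x < \<epsilon>) / \<P>(\<omega> in M. dist (X \<omega>) x' < \<epsilon>)) \<longlongrightarrow> L) (at_right 0) \<and>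
       L \<le> 1)"
    (is "_ \<longleftrightarrow> ?charged \<and> ?ratios")
proof
  interpret prob_space M by fact
  assume "is_mode M X x'"
  then obtain f g where
    g: "\<And>\<epsilon>. \<epsilon> > 0 \<Longrightarrow> g \<epsilon> > 0"
    and lim: "\<And>x. ((\<lambda>\<epsilon>. \<P>(\<omega> in M. dist (X \<omega>) x < \<epsilon>) / g \<epsilon>) \<longlongrightarrow> f x) (at_right 0)"
    and pos: "\<exists>x. f x > 0" and max: "\<And>x. f x \<le> f x'"
    unfolding is_mode_def fictitious_density_def by blast
  have "f x' > 0"
    using pos max by (meson less_le_trans)
  have ?charged
    using positive_limit_imp_balls_charged[OF assms(2) lim \<open>f x' > 0\<close>] by force
  moreover have ?ratios
  proof
    fix x
    have "((\<lambda>\<epsilon>. \<P>(\<omega> in M. dist (X \<omega>) x < \<epsilon>) / \<P>(\<omega> in M. dist (X \<omega>) x' < \<epsilon>))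
        \<longlongrightarrow> f x / f x') (at_right 0)"
      using \<open>f x' > 0\<close> by (intro tendsto_quotient_common_scale[OF lim lim _ g]) auto
    moreover have "f x / f x' \<le> 1"
      using max \<open>f x' > 0\<close> by simp
    ultimately show "\<exists>L. ((\<lambda>\<epsilon>. \<P>(\<omega> in M. dist (X \<omega>) x < \<epsilon>) / \<P>(\<omega> in M. dist (X \<omega>) x' < \<epsilon>))
        \<longlongrightarrow> L) (at_right 0) \<and> L \<le> 1"
      by blast
  qed
  ultimately show "?charged \<and> ?ratios" ..
next
  assume R: "?charged \<and> ?ratios"
  define g where "g \<epsilon> = \<P>(\<omega> in M. dist (X \<omega>) x' < \<epsilon>)" for \<epsilon>
  have g: "g \<epsilon> > 0" if "\<epsilon> > 0" for \<epsilon>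
    using R that by (simp add: g_def less_le)
  obtain f where
    lim: "\<And>x. ((\<lambda>\<epsilon>. \<P>(\<omega> in M. dist (X \<omega>) x < \<epsilon>) / g \<epsilon>) \<longlongrightarrow> f x) (at_right 0)"
    and le1: "\<And>x. f x \<le> 1"
    using choice[OF conjunct2[OF R]] unfolding g_def by blast
  have "f x \<ge> 0" for x
    by (rule tendsto_lowerbound[OF lim]) (auto simp: g_def)
  moreover have "f x' = 1"
  proof (rule tendsto_unique[OF trivial_limit_at_right_real lim])
    have "\<forall>\<^sub>F \<epsilon> in at_right 0. 1 = \<P>(\<omega> in M. dist (X \<omega>) x' < \<epsilon>) / g \<epsilon>"
      using eventually_at_right_less[of "0::real"]
    proof eventually_elim
      case (elim \<epsilon>)
      then show ?case using g[of \<epsilon>] unfolding g_def by simp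
    qed
    then show "((\<lambda>\<epsilon>. \<P>(\<omega> in M. dist (X \<omega>) x' < \<epsilon>) / g \<epsilon>) \<longlongrightarrow> 1) (at_right 0)"
      by (rule Lim_transform_eventually[OF tendsto_const])
  qed
  moreover from this have "f x' > 0" "\<And>x. f x \<le> f x'"
    using le1 by simp_all
  ultimately have "fictitious_density M X f"
    unfolding fictitious_density_def using g lim by blast
  with \<open>\<And>x. f x \<le> f x'\<close> show "is_mode M X x'"
    unfolding is_mode_def by blast
qed

end
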